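(* Let $g:\mathbb{R}^n\to\mathbb{R}$ be $K$-Lipschitz with respect to $\|\cdot\|_2$, with decomposition $g(\mathbf{x})=\tilde g(\mathbf{x}^{(1)})+\boldsymbol\beta^T\mathbf{x}^{(2)}$, where $\mathbf{x}=(\mathbf{x}^{(1)},\mathbf{x}^{(2)})$, $\mathbf{x}^{(1)}\in\mathbb{R}^m$, $\mathbf{x}^{(2)}\in\mathbb{R}^{n-m}$, $m\le n$, $\boldsymbol\beta\in\mathbb{R}^{n-m}$, and $\tilde g:\mathbb{R}^m\to\mathbb{R}$ is Lipschitz continuous. Let $\mathbf{X}\in\mathcal{L}^p_n$ with $g(\mathbf{X})\in\mathcal{L}^p$. Let $Q$ be a positive-semi-definite diagonal $n\times n$ matrix with at least one non-zero entry, and let $\lambda_{\min}\ge0$ and $\lambda_{\max}>0$ denote the smallest and largest eigenvalues of $Q$. Then, for any $\epsilon\ge0$, $$\mathfrak{B}_{\lambda_{\max}x^2,\,\|\boldsymbol\beta\|_2^2\epsilon}\big(g(\mathbf{X})\big)\subseteq g\big(\mathfrak{B}^n_{\mathbf{x}^TQ\mathbf{x},\,\epsilon}(\mathbf{X})\big)\subseteq\mathfrak{B}_{\lambda_{\min}x^2,\,K^2\epsilon}\big(g(\mathbf{X})\big).$$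
   Context: Fix $p\ge1$ and a non-atomic probability space $(\Omega,\mathcal{B},\mathbb{P})$ with $\mathcal{B}=\mathcal{B}(\mathbb{R}^n)$; all random variables/vectors live on it. $\mathcal{L}^p_n$ is the space of $n$-dimensional random vectors with $\mathbb{E}[\|\mathbf{X}\|^p]<\infty$, $\mathcal{L}^p=\mathcal{L}^p_1$. A Bregman generator is a convex (not necessarily strictly) differentiable function $\Phi$ on a convex domain of $\mathbb{R}^n$, with Bregman divergence $B_\Phi(\mathbf{z}_1,\mathbf{z}_2)=\Phi(\mathbf{z}_1)-\Phi(\mathbf{z}_2)-\nabla\Phi(\mathbf{z}_2)\cdot(\mathbf{z}_1-\mathbf{z}_2)$. The Bregman-Wasserstein divergence is $\mathcal{B}^n_\Phi[F,G]=\inf\mathbb{E}[B_\Phi(\mathbf{X},\mathbf{Y})]$ over all couplings with $F_{\mathbf{X}}=F$, $F_{\mathbf{Y}}=G$, and $\mathfrak{B}^n_{\Phi,\epsilon}(\mathbf{X})=\{\mathbf{Z}:\mathcal{B}^n_\Phi[F_{\mathbf{Z}},F_{\mathbf{X}}]\le\epsilon\}$ (superscript dropped for $n=1$). The subscript is the generator: $\mathfrak{B}^n_{\mathbf{x}^TQ\mathbf{x},\epsilon}$ uses $\Phi(\mathbf{x})=\mathbf{x}^TQ\mathbf{x}$, whose Bregman divergence is $(\mathbf{z}_1-\mathbf{z}_2)^TQ(\mathbf{z}_1-\mathbf{z}_2)$; $\mathfrak{B}_{\lambda x^2,\delta}$ uses $\phi(x)=\lambda x^2$, with divergence $\lambda(z_1-z_2)^2$.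 It is tacitly assumed that BW uncertainty sets contain at least two elements. $g(\mathcal{S})=\{g(\mathbf{Z}):\mathbf{Z}\in\mathcal{S}\}$. Conventions on the decomposition: if $g$ has no linear components then $m=n$ and $\tilde g=g$ (so $\|\boldsymbol\beta\|_2=0$); otherwise the smallest possible $m$ is chosen. Standing assumption: $g$ is non-constant.
   Formalization: The left inclusion is proved with random variables identified when equal in distribution (inclusion of sets of laws), since it fails for individual random variables on a fixed Borel probability space; the right inclusion is proved as stated. *)

theory Defs
  imports "HOL-Probability.Probability"
begin

definition nonatomic :: "'w measure \<Rightarrow> bool" where
  "nonatomic M \<longleftrightarrow>
     (\<forall>A\<in>sets M. 0 < measure M A \<longrightarrow>
        (\<exists>B\<in>sets M. B \<subseteq> A \<and> 0 < measure M B \<and> measure M B < measure M A))"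

definition Lp_vec :: "'w measure \<Rightarrow> real \<Rightarrow> ('w \<Rightarrow> 'a::euclidean_space) set" where
  "Lp_vec M p = {X \<in> borel_measurable M. integrable M (\<lambda>\<omega>. norm (X \<omega>) powr p)}"

definition gradient :: "('a::euclidean_space \<Rightarrow> real) \<Rightarrow> 'a \<Rightarrow> 'a" where
  "gradient \<Phi> z = (THE D. GDERIV \<Phi> z :> D)"

definition bregman :: "('a::euclidean_space \<Rightarrow> real) \<Rightarrow> 'a \<Rightarrow> 'a \<Rightarrow> real" where
  "bregman \<Phi> z1 z2 = \<Phi> z1 - \<Phi> z2 - gradient \<Phi> z2 \<bullet> (z1 - z2)"

(* Random vectors on M with prescribed marginal laws. *)
definition couplings ::
  "'w measure \<Rightarrow> 'a::euclidean_space measure \<Rightarrow> 'a measure \<Rightarrow> (('w \<Rightarrow> 'a) \<times> ('w \<Rightarrow> 'a)) set" where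
  "couplings M F G = {(X, Y). X \<in> borel_measurable M \<and> Y \<in> borel_measurable M \<and>
                              distr M borel X = F \<and> distr M borel Y = G}"

(* Bregman divergences of convex generators are nonnegative, so the nonnegative integral is the
   expectation, with value infinity when the divergence is not integrable. *)
definition bregman_wasserstein ::
  "'w measure \<Rightarrow> ('a::euclidean_space \<Rightarrow> real) \<Rightarrow> 'a measure \<Rightarrow> 'a measure \<Rightarrow> ennreal" where
  "bregman_wasserstein M \<Phi> F G =
     (INF (X, Y)\<in>couplings M F G. \<integral>\<^sup>+ \<omega>. ennreal (bregman \<Phi> (X \<omega>) (Y \<omega>)) \<partial>M)"

definition bw_set ::
  "'w measure \<Rightarrow> ('a::euclidean_space \<Rightarrow> real) \<Rightarrow> real \<Rightarrow> ('w \<Rightarrow> 'a) \<Rightarrow> ('w \<Rightarrow> 'a) set" where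
  "bw_set M \<Phi> \<epsilon> X = {Z \<in> borel_measurable M.
     bregman_wasserstein M \<Phi> (distr M borel Z) (distr M borel X) \<le> ennreal \<epsilon>}"

(* Uncertainty sets depend on laws only. An inclusion between sets of random variables whose
   members are identified when equal in distribution is an inclusion between their sets of laws. *)
definition laws :: "'w measure \<Rightarrow> ('w \<Rightarrow> 'a::euclidean_space) set \<Rightarrow> 'a measure set" where
  "laws M S = distr M borel ` S"

(* e numbers the coordinates as e 0, ..., e (n - 1), n = CARD('n). A Lipschitz function on R^m is
   a function of sequences which is Lipschitz for the Euclidean distance of the first m entries;
   in particular it depends on those entries only. The vector \<beta> in R^(n-m) is given by the
   entries \<beta> i with i < n - m. The cases m = 0 and m = n (no linear part) are included. *)
definition linear_decomposition ::
  "(nat \<Rightarrow> 'n::finite) \<Rightarrow> (real^'n \<Rightarrow> real) \<Rightarrow> nat \<Rightarrow> ((nat \<Rightarrow> real) \<Rightarrow> real) \<Rightarrow> (nat \<Rightarrow> real) \<Rightarrow> bool" where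
  "linear_decomposition e g m gt \<beta> \<longleftrightarrow>
     m \<le> CARD('n) \<and>
     (\<exists>L. \<forall>u v. \<bar>gt u - gt v\<bar> \<le> L * L2_set (\<lambda>i. u i - v i) {..<m}) \<and>
     (\<forall>x. g x = gt (\<lambda>i. x $ e i) + (\<Sum>i<CARD('n) - m. \<beta> i * x $ e (m + i)))"

definition eigenvalues :: "real^'n^'n \<Rightarrow> real set" where
  "eigenvalues A = {l. \<exists>v. v \<noteq> 0 \<and> A *v v = l *\<^sub>R v}"

end

theory Submission
  imports Defs
begin

text \<open>
  The right inclusion pushes couplings forward along the Lipschitz map g. For the left one, let
  W have the law of a member of the left-hand set and put V = g(X). The infimum in the
  one-dimensional divergence between W and V is attained by a U that has the law of W and is
  comonotone with V, and such a U exists on the given space together with X itself: since M is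
  non-atomic on the Borel sets, a Borel injection into the unit interval is atomless, it breaks
  the ties of V, and U is a quantile transform of the result. Then Z = X + (U - V) / |\<beta>|^2 \<beta>, with
  \<beta> acting on the linear coordinates, satisfies g(Z) = U, and its transport cost to X is at most
  1 / |\<beta>|^2 times that of U to V. If \<beta> = 0 then U = V almost surely and Z = X works.

  Optimality of U needs no moments: (u - v)^2 is the area of the square with side between u and v,
  so by Tonelli the cost is an integral of the probabilities
  P(V \<le> min s t, max s t < U) + P(U \<le> min s t, max s t < V), each minimal for comonotone pairs.
\<close>

section \<open>An injective Borel code in the unit interval, and null singletons\<close>

text \<open>At the first index \<open>n\<close> where the digits differ, the sums differ by
  \<open>(1/3) ^ Suc n\<close>, and all later digits together can undo at most half of that. Base 3
  with digits 0 and 1 avoids the double expansions of base 2.\<close>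

lemma suminf_ternary_digits_neq:
  fixes a b :: "nat \<Rightarrow> bool"
  assumes "a \<noteq> b"
  shows "(\<Sum>k. of_bool (a k) * (1/3::real) ^ Suc k) \<noteq> (\<Sum>k. of_bool (b k) * (1/3) ^ Suc k)"
proof -
  let ?d = "\<lambda>k. (of_bool (a k) - of_bool (b k)) * (1/3::real) ^ Suc k"
  have summ: "summable (\<lambda>k. of_bool (c k) * (1/3::real) ^ Suc k)" for c :: "nat \<Rightarrow> bool"
    by (rule summable_comparison_test'[of "\<lambda>k. (1/3::real) ^ Suc k" 0])
       (auto simp: summable_geometric_iff)
  have sumd: "summable ?d"
    using summable_diff[OF summ summ, of a b] by (simp only: left_diff_distrib)
  define n where "n = (LEAST k. a k \<noteq> b k)"
  have n: "a n \<noteq> b n"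
    using assms LeastI_ex[of "\<lambda>k. a k \<noteq> b k"] unfolding n_def by (simp add: fun_eq_iff)
  have below: "a k = b k" if "k < n" for k
    using not_less_Least[of k "\<lambda>k. a k \<noteq> b k"] that by (auto simp: n_def)
  have tail: "\<bar>\<Sum>k. ?d (k + Suc n)\<bar> \<le> (1/3) ^ Suc n / 2"
  proof -
    have geo: "(\<lambda>k. (1/3::real) ^ Suc (k + Suc n)) sums ((1/3) ^ Suc n / 2)"
      using sums_mult[OF geometric_sums[of "1/3::real"], of "(1/3) ^ Suc (Suc n)"]
      by (simp add: power_add field_simps)
    have "norm (\<Sum>k. ?d (k + Suc n)) \<le> (\<Sum>k. (1/3::real) ^ Suc (k + Suc n))"
      by (rule norm_suminf_le) (use geo in \<open>auto simp: sums_iff\<close>)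
    then show ?thesis
      using geo by (simp add: sums_iff)
  qed
  have "suminf ?d = (\<Sum>k. ?d (k + Suc n)) + (\<Sum>k<Suc n. ?d k)"
    by (rule suminf_split_initial_segment[OF sumd])
  also have "(\<Sum>k<Suc n. ?d k) = ?d n"
    by (simp add: below)
  finally have split: "suminf ?d = (\<Sum>k. ?d (k + Suc n)) + ?d n" .
  have "\<bar>?d n\<bar> = (1/3) ^ Suc n"
    using n by (cases "a n"; cases "b n") auto
  moreover have "(1/3::real) ^ Suc n > 0"
    by simp
  ultimately have "suminf ?d \<noteq> 0"
    using tail split by linarith
  moreover have "suminf ?d =
      (\<Sum>k. of_bool (a k) * (1/3::real) ^ Suc k) - (\<Sum>k. of_bool (b k) * (1/3) ^ Suc k)"
    using suminf_diff[OF summ summ, of a b] by (simp only: left_diff_distrib)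
  ultimately show ?thesis by simp
qed

text \<open>A point is coded by its memberships in a countable basis, read as ternary digits. The T0
  axiom makes distinct points have distinct membership sequences.\<close>

lemma exists_borel_injection_unit_interval:
  "\<exists>h :: 'a::{second_countable_topology, t0_space} \<Rightarrow> real.
     h \<in> borel_measurable borel \<and> inj h \<and> range h \<subseteq> {0..1}"
proof -
  obtain B :: "'a set set" where B: "countable B" "topological_basis B"
    using ex_countable_basis by blast
  \<comment> \<open>Inserting the empty set makes the enumerated family visibly non-empty; it
    separates no points and only contributes zero digits.\<close>
  define A where "A = from_nat_into (insert {} B)"
  have rA: "range A = insert {} B"
    unfolding A_def using B(1) by (simp add: range_from_nat_into)
  have [measurable]: "A k \<in> sets borel" for k
    using rA B(2) topological_basis_open by (metis borel_open insertE open_empty rangeI)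
  define h where "h x = (\<Sum>k. of_bool (x \<in> A k) * (1/3::real) ^ Suc k)" for x
  have [measurable]: "h \<in> borel_measurable borel"
    unfolding h_def by measurable
  have "inj h"
  proof (rule injI, rule ccontr)
    fix x y assume eq: "h x = h y" and "x \<noteq> y"
    then obtain U where U: "open U" "x \<in> U \<longleftrightarrow> y \<notin> U"
      using separation_t0[of x y] by auto
    \<comment> \<open>\<open>z\<close> is the one of the two points that lies in \<open>U\<close>; a
      basis set between \<open>z\<close> and \<open>U\<close> then contains it and misses the
      other.\<close>
    define z where "z = (if x \<in> U then x else y)"
    obtain b where b: "b \<in> B" "z \<in> b" "b \<subseteq> U"
      using topological_basisE[OF B(2) U(1), of z] U(2) unfolding z_def by metis
    then have "x \<in> b \<longleftrightarrow> y \<notin> b"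
      using U(2) by (auto simp: z_def split: if_splits)
    with b(1) obtain k where "x \<in> A k \<longleftrightarrow> y \<notin> A k"
      using rA by (metis insertCI rangeE)
    then have "(\<lambda>k. x \<in> A k) \<noteq> (\<lambda>k. y \<in> A k)"
      by metis
    then show False
      using suminf_ternary_digits_neq eq unfolding h_def by blast
  qed
  moreover have "h x \<in> {0..1}" for x
  proof -
    have geo: "(\<lambda>k. (1/3::real) ^ Suc k) sums (1/2)"
      using sums_mult[OF geometric_sums[of "1/3::real"], of "1/3"] by simp
    have s: "summable (\<lambda>k. of_bool (x \<in> A k) * (1/3::real) ^ Suc k)"
      by (rule summable_comparison_test'[of "\<lambda>k. (1/3::real) ^ Suc k" 0])
         (auto simp: summable_geometric_iff)
    have "h x \<le> (\<Sum>k. (1/3::real) ^ Suc k)"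
      unfolding h_def by (rule suminf_le[OF _ s]) (use geo in \<open>auto simp: sums_iff\<close>)
    moreover have "0 \<le> h x"
      unfolding h_def by (rule suminf_nonneg[OF s]) auto
    ultimately show ?thesis
      using geo by (simp add: sums_iff)
  qed
  ultimately show ?thesis
    by (intro exI[of _ h]) auto
qed

lemma nonatomic_measure_singleton:
  fixes M :: "'a::t1_space measure"
  assumes "sets M = sets borel" "nonatomic M"
  shows "measure M {x} = 0"
proof (rule ccontr)
  assume "measure M {x} \<noteq> 0"
  then have "0 < measure M {x}"
    by (simp add: zero_less_measure_iff)
  moreover have "{x} \<in> sets M"
    using assms(1) by simp
  ultimately obtain B where "B \<subseteq> {x}" "0 < measure M B" "measure M B < measure M {x}"
    using assms(2) unfolding nonatomic_def by blast
  then show False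
    by (metis less_irrefl measure_empty subset_singletonD)
qed

section \<open>Comonotone rearrangements on a given probability space\<close>

text \<open>This breaks the ties of \<open>V\<close> while preserving its order, so that the cdf of
  \<open>S\<close> is continuous. The values of \<open>S\<close> over a level \<open>V = v\<close>
  lie in the interval from \<open>v + P v\<close> to \<open>v + C v\<close>, and these intervals are
  disjoint for different \<open>v\<close>. The summand \<open>V\<close> keeps the order strict even
  across gaps that carry no mass.\<close>

lemma (in prob_space) exists_atomless_strict_refinement:
  fixes V h :: "'a \<Rightarrow> real"
  assumes [measurable]: "V \<in> borel_measurable M" "h \<in> borel_measurable M"
    and h01: "\<And>\<omega>. h \<omega> \<in> {0..1}"
    and atomless: "\<And>c. prob {\<omega>\<in>space M. h \<omega> = c} = 0"
  shows "\<exists>S :: 'a \<Rightarrow> real. S \<in> borel_measurable M \<and> (\<forall>c. prob {\<omega>\<in>space M. S \<omega> = c} = 0)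
           \<and> (\<forall>\<omega> \<omega>'. V \<omega> < V \<omega>' \<longrightarrow> S \<omega> < S \<omega>')"
proof -
  define P where "P v = prob {\<omega>\<in>space M. V \<omega> < v}" for v
  define C where "C v = prob {\<omega>\<in>space M. V \<omega> \<le> v}" for v
  \<comment> \<open>Adding P opens a gap at each atom of V, over which the values of h are spread.\<close>
  define S where "S \<omega> = V \<omega> + (P (V \<omega>) + (C (V \<omega>) - P (V \<omega>)) * h \<omega>)" for \<omega>
  have PC: "P v \<le> C v" for v
    unfolding P_def C_def by (intro finite_measure_mono) auto
  have CP: "C v \<le> P w" if "v < w" for v w
    unfolding P_def C_def using that by (intro finite_measure_mono) auto
  have [measurable]: "P \<in> borel_measurable borel" "C \<in> borel_measurable borel"
    by (auto intro!: borel_measurable_mono monoI finite_measure_mono simp: P_def C_def)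
  have [measurable]: "S \<in> borel_measurable M"
    unfolding S_def by measurable
  have between: "V \<omega> + P (V \<omega>) \<le> S \<omega>" "S \<omega> \<le> V \<omega> + C (V \<omega>)" for \<omega>
    using PC[of "V \<omega>"] h01[of \<omega>] mult_left_le[of "h \<omega>" "C (V \<omega>) - P (V \<omega>)"]
    by (auto simp: S_def)
  have strict: "S \<omega> < S \<omega>'" if "V \<omega> < V \<omega>'" for \<omega> \<omega>'
    using between[of \<omega>] between[of \<omega>'] CP[OF that] that by linarith
  have "prob {\<omega>\<in>space M. S \<omega> = c} = 0" for c
  proof (cases "{\<omega>\<in>space M. S \<omega> = c} = {}")
    case False
    then obtain \<omega>0 where \<omega>0: "S \<omega>0 = c" by auto
    let ?v = "V \<omega>0"
    \<comment> \<open>By strictness a level of \<open>S\<close> sits inside a single level of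
      \<open>V\<close>. Either that level of \<open>V\<close> is null, or \<open>S\<close> is there
      an injective affine function of \<open>h\<close>, and the atomlessness of \<open>h\<close>
      applies.\<close>
    have V0: "V \<omega> = ?v" if "S \<omega> = c" for \<omega>
      using strict[of \<omega> \<omega>0] strict[of \<omega>0 \<omega>] that \<omega>0 by (metis less_irrefl linorder_neqE)
    show ?thesis
    proof (cases "C ?v - P ?v = 0")
      case True
      have "C ?v = P ?v + prob {\<omega>\<in>space M. V \<omega> = ?v}"
        unfolding C_def P_def
        by (subst finite_measure_Union[symmetric]) (auto intro!: arg_cong[where f=prob])
      moreover have "prob {\<omega>\<in>space M. S \<omega> = c} \<le> prob {\<omega>\<in>space M. V \<omega> = ?v}"
        by (rule finite_measure_mono) (use V0 in auto)
      ultimately show ?thesis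
        using True measure_nonneg[of M "{\<omega>\<in>space M. S \<omega> = c}"] by linarith
    next
      case False
      have "h \<omega> = h \<omega>0" if "S \<omega> = c" for \<omega>
        using V0[OF that] that \<omega>0 False by (auto simp: S_def)
      then have "prob {\<omega>\<in>space M. S \<omega> = c} \<le> prob {\<omega>\<in>space M. h \<omega> = h \<omega>0}"
        by (intro finite_measure_mono) auto
      then show ?thesis
        using atomless[of "h \<omega>0"] by (simp add: measure_le_0_iff)
    qed
  qed (metis measure_empty)
  then show ?thesis
    using strict by (intro exI[of _ S]) auto
qed

text \<open>This is the probability integral transform. Without atoms the cdf is continuous and
  takes every value strictly between 0 and 1, so the event can be compared with events
  \<open>S \<le> c\<close> whose probability is known.\<close>

lemma (in prob_space) prob_cdf_le_of_atomless:
  fixes S :: "'a \<Rightarrow> real"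
  assumes [measurable]: "S \<in> borel_measurable M"
    and atomless: "\<And>c. prob {\<omega>\<in>space M. S \<omega> = c} = 0"
    and r: "0 \<le> r" "r \<le> 1"
  shows "prob {\<omega>\<in>space M. cdf (distr M borel S) (S \<omega>) \<le> r} = r"
proof -
  interpret D: real_distribution "distr M borel S" by simp
  let ?F = "cdf (distr M borel S)"
  have F: "?F c = prob {\<omega>\<in>space M. S \<omega> \<le> c}" for c
    by (auto simp: cdf_def measure_distr intro!: arg_cong[where f=prob])
  have "measure (distr M borel S) {c} = 0" for c
    using atomless[of c] by (simp add: measure_distr vimage_def Int_def conj_commute)
  then have cont: "isCont ?F c" for c
    using D.isCont_cdf by blast
  have mono: "?F c \<le> ?F d" if "c \<le> d" for c d
    using that by (rule D.cdf_nondecreasing)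
  have [measurable]: "?F \<in> borel_measurable borel"
    by (intro borel_measurable_mono monoI mono)
  have ivt: "\<exists>c. ?F c = q" if "0 < q" "q < 1" for q
  proof -
    obtain a where a: "?F a < q"
      by (metis eventually_happens' trivial_limit_at_bot_linorder order_tendstoD(2)
          D.cdf_lim_at_bot \<open>0 < q\<close>)
    obtain b where b: "q < ?F b"
      by (metis eventually_happens' trivial_limit_at_top_linorder order_tendstoD(1)
          D.cdf_lim_at_top_prob \<open>q < 1\<close>)
    have "a \<le> b"
      using mono[of b a] a b by linarith
    then show ?thesis
      using IVT[of ?F a q b] a b cont by auto
  qed
  let ?p = "prob {\<omega>\<in>space M. ?F (S \<omega>) \<le> r}"
  \<comment> \<open>The values 0 and 1 need not be attained by the cdf, and it may be flat at height
    \<open>r\<close>. Hence \<open>r\<close> is only approached, through \<open>q\<close> on either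
    side.\<close>
  have lower: "q \<le> ?p" if qr: "q < r" for q
  proof (cases "0 < q")
    case True
    then obtain c where c: "?F c = q" using ivt[of q] qr r by force
    have "prob {\<omega>\<in>space M. S \<omega> \<le> c} \<le> ?p"
      by (intro finite_measure_mono) (use mono[of _ c] c qr in force)+
    then show ?thesis using c F by simp
  qed (use measure_nonneg[of M "{\<omega>\<in>space M. ?F (S \<omega>) \<le> r}"] in linarith)
  have upper: "?p \<le> q" if qr: "r < q" for q
  proof (cases "q < 1")
    case True
    then obtain c where c: "?F c = q" using ivt[of q] qr r by force
    have "S \<omega> \<le> c" if "?F (S \<omega>) \<le> r" for \<omega>
      using mono[of c "S \<omega>"] c qr that by linarith
    then have "?p \<le> prob {\<omega>\<in>space M. S \<omega> \<le> c}"
      by (intro finite_measure_mono) auto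
    then show ?thesis using c F by simp
  qed (use prob_le_1[of "{\<omega>\<in>space M. ?F (S \<omega>) \<le> r}"] in linarith)
  show ?thesis
    using dense_le[of r ?p] dense_ge[of r ?p] lower upper by (intro antisym) auto
qed

text \<open>\<open>R\<close>, the cdf of \<open>S\<close> evaluated at \<open>S\<close>, is uniform
  and ordered like \<open>V\<close>; the quantile function of \<open>\<nu>\<close> applied to it
  gives the required law and preserves the order.\<close>

lemma (in prob_space) exists_comonotone_with_law:
  fixes V h :: "'a \<Rightarrow> real"
  assumes [measurable]: "V \<in> borel_measurable M" "h \<in> borel_measurable M"
    and h01: "\<And>\<omega>. h \<omega> \<in> {0..1}"
    and atomless: "\<And>c. prob {\<omega>\<in>space M. h \<omega> = c} = 0"
    and "real_distribution \<nu>"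
  shows "\<exists>U\<in>borel_measurable M. distr M borel U = \<nu> \<and>
           (\<exists>A\<in>events. prob A = 1 \<and> (\<forall>\<omega>\<in>A. \<forall>\<omega>'\<in>A. V \<omega> < V \<omega>' \<longrightarrow> U \<omega> \<le> U \<omega>'))"
proof -
  obtain S :: "'a \<Rightarrow> real" where [measurable]: "S \<in> borel_measurable M"
    and S_atomless: "\<And>c. prob {\<omega>\<in>space M. S \<omega> = c} = 0"
    and S_mono: "\<And>\<omega> \<omega>'. V \<omega> < V \<omega>' \<Longrightarrow> S \<omega> < S \<omega>'"
    using exists_atomless_strict_refinement[OF assms(1-4)] by blast
  interpret D: real_distribution "distr M borel S" by simp
  interpret N: cdf_distribution \<nu>
    unfolding cdf_distribution_def by (rule assms(5))
  define R where "R \<omega> = cdf (distr M borel S) (S \<omega>)" for \<omega>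
  have "cdf (distr M borel S) \<in> borel_measurable borel"
    by (intro borel_measurable_mono monoI D.cdf_nondecreasing)
  then have [measurable]: "R \<in> borel_measurable M"
    unfolding R_def by measurable
  have unif: "prob {\<omega>\<in>space M. R \<omega> \<le> r} = r" if "0 \<le> r" "r \<le> 1" for r
    unfolding R_def using that S_atomless by (intro prob_cdf_le_of_atomless) auto
  \<comment> \<open>The quantile function is controlled only on the open unit interval, so the order
    is claimed on this event of full probability.\<close>
  let ?A = "{\<omega>\<in>space M. 0 < R \<omega> \<and> R \<omega> < 1}"
  have "AE \<omega> in M. \<not> R \<omega> \<le> 0"
    using unif[of 0] by (intro AE_I[of _ _ "{\<omega>\<in>space M. R \<omega> \<le> 0}"]) (auto simp: emeasure_eq_measure)
  moreover have "AE \<omega> in M. R \<omega> < 1"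
  proof -
    \<comment> \<open>\<open>unif\<close> at 1 does not exclude mass at \<open>R = 1\<close>, so the
      bound is taken at levels \<open>q\<close> below 1.\<close>
    have upper: "prob {\<omega>\<in>space M. R \<omega> \<ge> 1} \<le> 1 - q" if "0 < q" "q < 1" for q
    proof -
      have "prob {\<omega>\<in>space M. R \<omega> \<ge> 1} \<le> prob (space M - {\<omega>\<in>space M. R \<omega> \<le> q})"
        by (intro finite_measure_mono) (use that in auto)
      also have "\<dots> = 1 - q"
        using unif[of q] that by (subst prob_compl) auto
      finally show ?thesis .
    qed
    have "prob {\<omega>\<in>space M. R \<omega> \<ge> 1} \<le> q" if "0 < q" "q < 1" for q
      using upper[of "1 - q"] that by simp
    then have "prob {\<omega>\<in>space M. R \<omega> \<ge> 1} \<le> 0"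
      by (intro dense_ge_bounded[of 0 1]) auto
    then have "prob {\<omega>\<in>space M. R \<omega> \<ge> 1} = 0"
      by (simp add: measure_le_0_iff)
    then show ?thesis
      by (intro AE_I[of _ _ "{\<omega>\<in>space M. R \<omega> \<ge> 1}"]) (auto simp: emeasure_eq_measure)
  qed
  ultimately have AE_A: "AE \<omega> in M. \<omega> \<in> ?A"
    using AE_space by eventually_elim auto
  then have "prob ?A = 1"
    by (simp add: prob_eq_1)
  \<comment> \<open>The default 0 makes \<open>q\<close> total and Borel; it is used only on a null
    event.\<close>
  define q where "q r = (if r \<in> {0<..<1} then N.I r else 0)" for r
  have [measurable]: "q \<in> borel_measurable borel"
    unfolding q_def
    using N.measurable_CI by (subst (asm) measurable_restrict_space_iff[where c=0]) auto
  define U where "U \<omega> = q (R \<omega>)" for \<omega>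
  have [measurable]: "U \<in> borel_measurable M"
    unfolding U_def by measurable
  have "distr M borel U = \<nu>"
  proof (rule cdf_unique)
    show "cdf (distr M borel U) = cdf \<nu>"
    proof
      fix t
      have "cdf (distr M borel U) t = prob {\<omega>\<in>space M. U \<omega> \<le> t}"
        by (auto simp: cdf_def measure_distr intro!: arg_cong[where f=prob])
      also have "\<dots> = prob {\<omega>\<in>space M. R \<omega> \<le> cdf \<nu> t}"
      proof (rule finite_measure_eq_AE)
        show "AE \<omega> in M. \<omega> \<in> {\<omega>\<in>space M. U \<omega> \<le> t} \<longleftrightarrow> \<omega> \<in> {\<omega>\<in>space M. R \<omega> \<le> cdf \<nu> t}"
          \<comment> \<open>The Galois connection between quantile function and cdf:
            \<open>N.I r \<le> t\<close> iff \<open>r \<le> cdf \<nu> t\<close>.\<close>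
          using AE_A by eventually_elim (auto simp: U_def q_def N.pseudoinverse[symmetric])
      qed auto
      also have "\<dots> = cdf \<nu> t"
        by (rule unif) (auto simp: N.cdf_nonneg N.cdf_bounded_prob)
      finally show "cdf (distr M borel U) t = cdf \<nu> t" .
    qed
  qed (use assms(5) in auto)
  moreover have "U \<omega> \<le> U \<omega>'" if "\<omega> \<in> ?A" "\<omega>' \<in> ?A" "V \<omega> < V \<omega>'" for \<omega> \<omega>'
  proof -
    have "R \<omega> \<le> R \<omega>'"
      unfolding R_def using S_mono[OF that(3)] by (intro D.cdf_nondecreasing) auto
    then show ?thesis
      using that mono_onD[OF N.mono_I, of "R \<omega>" "R \<omega>'"] by (auto simp: U_def q_def)
  qed
  ultimately show ?thesis
    using \<open>prob ?A = 1\<close> by (intro bexI[of _ U] conjI bexI[of _ ?A]) auto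
qed

section \<open>Comonotone pairs minimize the expected squared difference\<close>

text \<open>At most one of the two squares is non-empty, depending on the sign of
  \<open>u - v\<close>. The intervals are half-open so that, for random endpoints, membership
  becomes events of the form \<open>V \<le> a\<close> and \<open>b < U\<close>, which suit
  cdfs.\<close>

lemma square_diff_eq_nn_integral_indicator:
  fixes u v :: real
  shows "ennreal ((u - v)\<^sup>2) =
    (\<integral>\<^sup>+ z. (indicator {v..<u} (fst z) * indicator {v..<u} (snd z) +
             indicator {u..<v} (fst z) * indicator {u..<v} (snd z)) \<partial>(lborel \<Otimes>\<^sub>M lborel))"
proof -
  have sq: "(\<integral>\<^sup>+ z. indicator {a..<b} (fst z) * indicator {a..<b} (snd z) \<partial>(lborel \<Otimes>\<^sub>M lborel))
      = ennreal (max 0 (b - a)) * ennreal (max 0 (b - a))" for a b :: real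
  proof -
    have "(\<integral>\<^sup>+ z. indicator {a..<b} (fst z) * indicator {a..<b} (snd z) \<partial>(lborel \<Otimes>\<^sub>M lborel))
        = (\<integral>\<^sup>+ z. indicator ({a..<b} \<times> {a..<b}) z \<partial>(lborel \<Otimes>\<^sub>M lborel))"
      by (rule nn_integral_cong) (simp add: indicator_times)
    also have "\<dots> = emeasure (lborel \<Otimes>\<^sub>M lborel) ({a..<b} \<times> {a..<b})"
      by (rule nn_integral_indicator) (rule pair_measureI, auto)
    also have "\<dots> = emeasure lborel {a..<b} * emeasure lborel {a..<b}"
      by (rule lborel.emeasure_pair_measure_Times) auto
    finally show ?thesis
      by (cases "a \<le> b") (simp_all add: max_def)
  qed
  have "(\<integral>\<^sup>+ z. (indicator {v..<u} (fst z) * indicator {v..<u} (snd z) +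
             indicator {u..<v} (fst z) * indicator {u..<v} (snd z)) \<partial>(lborel \<Otimes>\<^sub>M lborel)) =
     ennreal (max 0 (u - v)) * ennreal (max 0 (u - v)) +
     ennreal (max 0 (v - u)) * ennreal (max 0 (v - u))"
    by (subst nn_integral_add) (auto simp: sq)
  also have "\<dots> = ennreal ((u - v)\<^sup>2)"
    by (auto simp: max_def power2_eq_square ennreal_mult'[symmetric] algebra_simps)
  finally show ?thesis by simp
qed

lemma (in prob_space) nn_integral_square_diff_eq:
  fixes U V :: "'a \<Rightarrow> real"
  assumes [measurable]: "U \<in> borel_measurable M" "V \<in> borel_measurable M"
  shows "(\<integral>\<^sup>+ \<omega>. ennreal ((U \<omega> - V \<omega>)\<^sup>2) \<partial>M) =
    (\<integral>\<^sup>+ z. (emeasure M {\<omega>\<in>space M. V \<omega> \<le> min (fst z) (snd z) \<and> max (fst z) (snd z) < U \<omega>} +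
             emeasure M {\<omega>\<in>space M. U \<omega> \<le> min (fst z) (snd z) \<and> max (fst z) (snd z) < V \<omega>})
       \<partial>(lborel \<Otimes>\<^sub>M lborel))"
proof -
  let ?L = "lborel \<Otimes>\<^sub>M lborel :: (real \<times> real) measure"
  have "sigma_finite_measure ?L"
    by (simp only: lborel_prod sigma_finite_lborel)
  then interpret P: pair_sigma_finite M ?L
    by (simp add: pair_sigma_finite.intro sigma_finite_measure_axioms)
  let ?f = "\<lambda>\<omega> z. indicator {V \<omega>..<U \<omega>} (fst z) * indicator {V \<omega>..<U \<omega>} (snd z) +
             indicator {U \<omega>..<V \<omega>} (fst z) * indicator {U \<omega>..<V \<omega>} (snd z) :: ennreal"
  \<comment> \<open>The endpoints depend on \<open>\<omega>\<close>; in conditional form joint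
    measurability reduces to comparisons of measurable functions.\<close>
  have ind: "indicator {a..<b} x = (if a \<le> x \<and> x < b then 1 else 0 :: ennreal)" for a b x :: real
    by (auto split: split_indicator)
  have [measurable]: "case_prod ?f \<in> borel_measurable (M \<Otimes>\<^sub>M ?L)"
    unfolding ind by measurable
  have "(\<integral>\<^sup>+ \<omega>. ennreal ((U \<omega> - V \<omega>)\<^sup>2) \<partial>M) = (\<integral>\<^sup>+ \<omega>. \<integral>\<^sup>+ z. ?f \<omega> z \<partial>?L \<partial>M)"
    by (simp add: square_diff_eq_nn_integral_indicator)
  also have "\<dots> = (\<integral>\<^sup>+ z. \<integral>\<^sup>+ \<omega>. ?f \<omega> z \<partial>M \<partial>?L)"
    using P.Fubini'[of ?f] by simp
  also have "(\<lambda>z. \<integral>\<^sup>+ \<omega>. ?f \<omega> z \<partial>M) = (\<lambda>z.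
      emeasure M {\<omega>\<in>space M. V \<omega> \<le> min (fst z) (snd z) \<and> max (fst z) (snd z) < U \<omega>} +
      emeasure M {\<omega>\<in>space M. U \<omega> \<le> min (fst z) (snd z) \<and> max (fst z) (snd z) < V \<omega>})"
  proof
    fix z :: "real \<times> real"
    let ?A = "{\<omega>\<in>space M. V \<omega> \<le> min (fst z) (snd z) \<and> max (fst z) (snd z) < U \<omega>}"
    let ?B = "{\<omega>\<in>space M. U \<omega> \<le> min (fst z) (snd z) \<and> max (fst z) (snd z) < V \<omega>}"
    have "(\<integral>\<^sup>+ \<omega>. ?f \<omega> z \<partial>M) = (\<integral>\<^sup>+ \<omega>. indicator ?A \<omega> + indicator ?B \<omega> \<partial>M)"
      by (rule nn_integral_cong) (auto split: split_indicator)
    also have "\<dots> = emeasure M ?A + emeasure M ?B"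
      by (subst nn_integral_add) auto
    finally show "(\<integral>\<^sup>+ \<omega>. ?f \<omega> z \<partial>M) = emeasure M ?A + emeasure M ?B" .
  qed
  finally show ?thesis .
qed

text \<open>Every coupling satisfies P(V \<le> a, U > b) \<ge> max 0 (P(V \<le> a) - P(U \<le> b)), with equality
  when the events V \<le> a and U \<le> b are nested.\<close>

lemma (in prob_space) prob_le_gt_of_nested:
  fixes U V U' V' :: "'a \<Rightarrow> real"
  assumes [measurable]: "U \<in> borel_measurable M" "V \<in> borel_measurable M"
    "U' \<in> borel_measurable M" "V' \<in> borel_measurable M"
    and laws: "distr M borel U' = distr M borel U" "distr M borel V' = distr M borel V"
    and A: "A \<in> events" "prob A = 1"
    and nested: "(\<forall>\<omega>\<in>A. V \<omega> \<le> a \<longrightarrow> U \<omega> \<le> b) \<or> (\<forall>\<omega>\<in>A. U \<omega> \<le> b \<longrightarrow> V \<omega> \<le> a)"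
  shows "prob {\<omega>\<in>space M. V \<omega> \<le> a \<and> b < U \<omega>} \<le> prob {\<omega>\<in>space M. V' \<omega> \<le> a \<and> b < U' \<omega>}"
proof -
  have law: "prob {\<omega>\<in>space M. W' \<omega> \<le> c} = prob {\<omega>\<in>space M. W \<omega> \<le> c}"
    if "distr M borel W' = distr M borel W" and [measurable]: "W \<in> borel_measurable M" "W' \<in> borel_measurable M"
    for W W' :: "'a \<Rightarrow> real" and c
  proof -
    have "prob {\<omega>\<in>space M. Y \<omega> \<le> c} = measure (distr M borel Y) {..c}"
      if [measurable]: "Y \<in> borel_measurable M" for Y :: "'a \<Rightarrow> real"
      by (auto simp: measure_distr intro!: arg_cong[where f=prob])
    then show ?thesis using that by simp
  qed
  have AE_A: "AE \<omega> in M. \<omega> \<in> A"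
    using A by (simp add: prob_eq_1)
  show ?thesis
    using nested
  proof
    assume "\<forall>\<omega>\<in>A. V \<omega> \<le> a \<longrightarrow> U \<omega> \<le> b"
    then have "prob {\<omega>\<in>space M. V \<omega> \<le> a \<and> b < U \<omega>} = prob {}"
      using AE_A by (intro finite_measure_eq_AE) (auto elim!: eventually_mono)
    then show ?thesis by simp
  next
    assume "\<forall>\<omega>\<in>A. U \<omega> \<le> b \<longrightarrow> V \<omega> \<le> a"
    then have "prob {\<omega>\<in>space M. V \<omega> \<le> a \<and> b < U \<omega>} =
        prob ({\<omega>\<in>space M. V \<omega> \<le> a} - {\<omega>\<in>space M. V \<omega> \<le> a \<and> U \<omega> \<le> b})"
      by (intro arg_cong[where f=prob]) auto
    also have "\<dots> = prob {\<omega>\<in>space M. V \<omega> \<le> a} - prob {\<omega>\<in>space M. V \<omega> \<le> a \<and> U \<omega> \<le> b}"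
      by (rule finite_measure_Diff) auto
    \<comment> \<open>Nesting absorbs one condition, leaving only marginal probabilities, which the
      primed pair shares. For that pair the intersection is merely at most
      \<open>prob {\<omega>\<in>space M. U' \<omega> \<le> b}\<close>.\<close>
    also have "prob {\<omega>\<in>space M. V \<omega> \<le> a \<and> U \<omega> \<le> b} = prob {\<omega>\<in>space M. U \<omega> \<le> b}"
      using AE_A \<open>\<forall>\<omega>\<in>A. U \<omega> \<le> b \<longrightarrow> V \<omega> \<le> a\<close>
      by (intro finite_measure_eq_AE) (auto elim!: eventually_mono)
    also have "prob {\<omega>\<in>space M. V \<omega> \<le> a} = prob {\<omega>\<in>space M. V' \<omega> \<le> a}"
      using laws law[of V' V] by simp
    also have "prob {\<omega>\<in>space M. U \<omega> \<le> b} = prob {\<omega>\<in>space M. U' \<omega> \<le> b}"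
      using laws law[of U' U] by simp
    also have "prob {\<omega>\<in>space M. V' \<omega> \<le> a} - prob {\<omega>\<in>space M. U' \<omega> \<le> b} \<le>
        prob ({\<omega>\<in>space M. V' \<omega> \<le> a} - {\<omega>\<in>space M. V' \<omega> \<le> a \<and> U' \<omega> \<le> b})"
      by (subst finite_measure_Diff) (auto intro!: finite_measure_mono)
    also have "{\<omega>\<in>space M. V' \<omega> \<le> a} - {\<omega>\<in>space M. V' \<omega> \<le> a \<and> U' \<omega> \<le> b} =
        {\<omega>\<in>space M. V' \<omega> \<le> a \<and> b < U' \<omega>}"
      by auto
    finally show ?thesis .
  qed
qed

lemma (in prob_space) comonotone_minimizes_square_diff:
  fixes U V U' V' :: "'a \<Rightarrow> real"
  assumes [measurable]: "U \<in> borel_measurable M" "V \<in> borel_measurable M"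
    "U' \<in> borel_measurable M" "V' \<in> borel_measurable M"
    and laws: "distr M borel U' = distr M borel U" "distr M borel V' = distr M borel V"
    and A: "A \<in> events" "prob A = 1"
    and comonotone: "\<And>\<omega> \<omega>'. \<omega> \<in> A \<Longrightarrow> \<omega>' \<in> A \<Longrightarrow> V \<omega> < V \<omega>' \<Longrightarrow> U \<omega> \<le> U \<omega>'"
  shows "(\<integral>\<^sup>+ \<omega>. ennreal ((U \<omega> - V \<omega>)\<^sup>2) \<partial>M) \<le> (\<integral>\<^sup>+ \<omega>. ennreal ((U' \<omega> - V' \<omega>)\<^sup>2) \<partial>M)"
proof -
  \<comment> \<open>Witnesses against both inclusions would satisfy
    \<open>V \<omega> \<le> a < V \<omega>'\<close> and
    \<open>U \<omega>' \<le> b < U \<omega>\<close>, contradicting comonotonicity.\<close>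
  have nested: "(\<forall>\<omega>\<in>A. V \<omega> \<le> a \<longrightarrow> U \<omega> \<le> b) \<or> (\<forall>\<omega>\<in>A. U \<omega> \<le> b \<longrightarrow> V \<omega> \<le> a)" for a b
    using comonotone by (meson le_less_trans linorder_not_le)
  have "emeasure M {\<omega>\<in>space M. V \<omega> \<le> a \<and> b < U \<omega>} \<le> emeasure M {\<omega>\<in>space M. V' \<omega> \<le> a \<and> b < U' \<omega>}" for a b
    using prob_le_gt_of_nested[OF assms(1-8) nested] by (simp add: emeasure_eq_measure)
  moreover have "emeasure M {\<omega>\<in>space M. U \<omega> \<le> a \<and> b < V \<omega>} \<le> emeasure M {\<omega>\<in>space M. U' \<omega> \<le> a \<and> b < V' \<omega>}" for a b
    using prob_le_gt_of_nested[OF assms(2,1,4,3) laws(2,1) A] nested[of b a]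
    by (simp add: emeasure_eq_measure disj_commute)
  ultimately show ?thesis
    by (subst (1 2) nn_integral_square_diff_eq)
       (simp_all del: min.bounded_iff max_less_iff_conj min_le_iff_disj less_max_iff_disj
          add: nn_integral_mono add_mono)
qed

section \<open>Bregman divergences of quadratic generators\<close>

lemma bregman_eq_of_GDERIV:
  assumes "GDERIV \<Phi> z2 :> D"
  shows "bregman \<Phi> z1 z2 = \<Phi> z1 - \<Phi> z2 - D \<bullet> (z1 - z2)"
proof -
  have "gradient \<Phi> z2 = D"
    unfolding gradient_def
  proof (rule the_equality, rule assms)
    fix D' assume "GDERIV \<Phi> z2 :> D'"
    then have "(\<lambda>h. h \<bullet> D') = (\<lambda>h. h \<bullet> D)"
      using assms unfolding gderiv_def by (rule has_derivative_unique)
    then show "D' = D"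
      by (metis vector_eq_ldot)
  qed
  then show ?thesis by (simp add: bregman_def)
qed

lemma bregman_scaled_square: "bregman (\<lambda>x::real. c * x\<^sup>2) z1 z2 = c * (z1 - z2)\<^sup>2"
proof -
  have "GDERIV (\<lambda>x::real. c * x\<^sup>2) z2 :> 2 * c * z2"
    unfolding gderiv_deriv by (auto intro!: derivative_eq_intros)
  from bregman_eq_of_GDERIV[OF this, of z1] show ?thesis
    by (simp add: power2_eq_square algebra_simps)
qed

lemma bregman_quadratic_form:
  fixes Q :: "real^'n^'n"
  assumes "transpose Q = Q"
  shows "bregman (\<lambda>x. x \<bullet> (Q *v x)) z1 z2 = (z1 - z2) \<bullet> (Q *v (z1 - z2))"
proof -
  have sym: "x \<bullet> (Q *v y) = y \<bullet> (Q *v x)" for x y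
    using assms by (metis dot_lmul_matrix inner_commute transpose_matrix_vector)
  have lin: "bounded_linear ((*v) Q)"
    by (simp add: linear_conv_bounded_linear[symmetric])
  have "((\<lambda>x. x \<bullet> (Q *v x)) has_derivative (\<lambda>h. z2 \<bullet> (Q *v h) + h \<bullet> (Q *v z2))) (at z2)"
    by (rule has_derivative_inner[OF has_derivative_ident bounded_linear_imp_has_derivative[OF lin]])
  then have "GDERIV (\<lambda>x. x \<bullet> (Q *v x)) z2 :> 2 *\<^sub>R (Q *v z2)"
    unfolding gderiv_def by (simp add: sym[of z2])
  from bregman_eq_of_GDERIV[OF this] show ?thesis
    using sym[of z1 z2]
    by (simp add: matrix_vector_mult_diff_distrib inner_diff_left inner_diff_right inner_commute)
qed

section \<open>Transport of couplings and attainment of the one-dimensional infimum\<close>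

lemma bregman_wasserstein_le_coupling:
  assumes "A \<in> borel_measurable M" "B \<in> borel_measurable M"
    and "distr M borel A = F" "distr M borel B = G"
  shows "bregman_wasserstein M \<Phi> F G \<le> (\<integral>\<^sup>+ \<omega>. ennreal (bregman \<Phi> (A \<omega>) (B \<omega>)) \<partial>M)"
  unfolding bregman_wasserstein_def
  by (rule INF_lower2[of "(A, B)"]) (use assms in \<open>auto simp: couplings_def\<close>)

text \<open>Applying \<open>f\<close> to both members of a coupling multiplies its cost by at most
  \<open>c\<close>. No optimal coupling is assumed to exist, so a nearly optimal one is pushed
  forward.\<close>

lemma bw_set_comp:
  assumes [measurable]: "f \<in> borel_measurable borel" "X \<in> borel_measurable M"
    and [measurable]: "case_prod (bregman \<Phi>) \<in> borel_measurable (borel \<Otimes>\<^sub>M borel)"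
    and dom: "\<And>a b. bregman \<Psi> (f a) (f b) \<le> c * bregman \<Phi> a b"
    and "0 \<le> c" "0 \<le> \<epsilon>"
    and Z: "Z \<in> bw_set M \<Phi> \<epsilon> X"
  shows "f \<circ> Z \<in> bw_set M \<Psi> (c * \<epsilon>) (f \<circ> X)"
proof -
  have [measurable]: "Z \<in> borel_measurable M"
    and le: "bregman_wasserstein M \<Phi> (distr M borel Z) (distr M borel X) \<le> ennreal \<epsilon>"
    using Z by (auto simp: bw_set_def)
  have "bregman_wasserstein M \<Psi> (distr M borel (f \<circ> Z)) (distr M borel (f \<circ> X)) \<le> ennreal (c * \<epsilon>)"
  proof (rule ennreal_le_epsilon)
    fix \<delta> :: real assume "0 < \<delta>"
    \<comment> \<open>The denominator \<open>c + 1\<close> keeps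
      \<open>c * \<eta> \<le> \<delta>\<close> and also covers \<open>c = 0\<close>.\<close>
    define \<eta> where "\<eta> = \<delta> / (c + 1)"
    have "0 < \<eta>" "c * \<eta> \<le> \<delta>"
      using \<open>0 < \<delta>\<close> \<open>0 \<le> c\<close> by (auto simp: \<eta>_def field_simps)
    have "ennreal \<epsilon> < ennreal (\<epsilon> + \<eta>)"
      using \<open>0 < \<eta>\<close> \<open>0 \<le> \<epsilon>\<close> by (simp add: ennreal_less_iff)
    with le have "bregman_wasserstein M \<Phi> (distr M borel Z) (distr M borel X) < ennreal (\<epsilon> + \<eta>)"
      by (rule le_less_trans)
    then obtain A B where [measurable]: "A \<in> borel_measurable M" "B \<in> borel_measurable M"
      and laws: "distr M borel A = distr M borel Z" "distr M borel B = distr M borel X"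
      and small: "(\<integral>\<^sup>+ \<omega>. ennreal (bregman \<Phi> (A \<omega>) (B \<omega>)) \<partial>M) < ennreal (\<epsilon> + \<eta>)"
      unfolding bregman_wasserstein_def INF_less_iff by (auto simp: couplings_def)
    have law_comp: "distr M borel (f \<circ> C) = distr M borel (f \<circ> D)"
      if "distr M borel C = distr M borel D"
        and [measurable]: "C \<in> borel_measurable M" "D \<in> borel_measurable M" for C D
      using that(1) by (simp add: distr_distr[of f borel borel, symmetric])
    have "bregman_wasserstein M \<Psi> (distr M borel (f \<circ> Z)) (distr M borel (f \<circ> X)) \<le>
        (\<integral>\<^sup>+ \<omega>. ennreal (bregman \<Psi> ((f \<circ> A) \<omega>) ((f \<circ> B) \<omega>)) \<partial>M)"
      using law_comp[OF laws(1)] law_comp[OF laws(2)] unfolding comp_def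
      by (intro bregman_wasserstein_le_coupling) auto
    also have "\<dots> \<le> (\<integral>\<^sup>+ \<omega>. ennreal c * ennreal (bregman \<Phi> (A \<omega>) (B \<omega>)) \<partial>M)"
      using dom \<open>0 \<le> c\<close> by (intro nn_integral_mono) (simp add: ennreal_mult'[symmetric] ennreal_leI)
    also have "\<dots> = ennreal c * (\<integral>\<^sup>+ \<omega>. ennreal (bregman \<Phi> (A \<omega>) (B \<omega>)) \<partial>M)"
      by (rule nn_integral_cmult) measurable
    also have "\<dots> \<le> ennreal c * ennreal (\<epsilon> + \<eta>)"
      using small by (intro mult_left_mono) auto
    also have "\<dots> \<le> ennreal (c * \<epsilon>) + ennreal \<delta>"
      using \<open>0 \<le> c\<close> \<open>0 \<le> \<epsilon>\<close> \<open>0 < \<eta>\<close> \<open>c * \<eta> \<le> \<delta>\<close> \<open>0 < \<delta>\<close>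
      by (simp add: ennreal_mult[symmetric] ennreal_plus[symmetric] distrib_left del: ennreal_plus)
    finally show "bregman_wasserstein M \<Psi> (distr M borel (f \<circ> Z)) (distr M borel (f \<circ> X))
        \<le> ennreal (c * \<epsilon>) + ennreal \<delta>" .
  qed
  then show ?thesis
    by (simp add: bw_set_def)
qed

text \<open>The second member of the optimal pair is \<open>V\<close> itself and not just a variable
  with its law. This allows the main proof to take \<open>V = g \<circ> X\<close> and to shift the
  given \<open>X\<close>.\<close>

lemma (in prob_space) exists_optimal_square_coupling:
  fixes V Z h :: "'a \<Rightarrow> real"
  assumes [measurable]: "V \<in> borel_measurable M" "Z \<in> borel_measurable M"
    and h: "h \<in> borel_measurable M" "\<And>\<omega>. h \<omega> \<in> {0..1}" "\<And>c. prob {\<omega>\<in>space M. h \<omega> = c} = 0"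
    and "0 \<le> c"
  shows "\<exists>U\<in>borel_measurable M. distr M borel U = distr M borel Z \<and>
    (\<integral>\<^sup>+ \<omega>. ennreal (c * (U \<omega> - V \<omega>)\<^sup>2) \<partial>M)
      \<le> bregman_wasserstein M (\<lambda>x. c * x\<^sup>2) (distr M borel Z) (distr M borel V)"
proof -
  obtain U A where [measurable]: "U \<in> borel_measurable M"
    and lawU: "distr M borel U = distr M borel Z"
    and A: "A \<in> events" "prob A = 1" "\<And>\<omega> \<omega>'. \<omega> \<in> A \<Longrightarrow> \<omega>' \<in> A \<Longrightarrow> V \<omega> < V \<omega>' \<Longrightarrow> U \<omega> \<le> U \<omega>'"
    using exists_comonotone_with_law[OF assms(1) h real_distribution_distr[OF assms(2)]] by blast
  have "(\<integral>\<^sup>+ \<omega>. ennreal (c * (U \<omega> - V \<omega>)\<^sup>2) \<partial>M) \<le> (\<integral>\<^sup>+ \<omega>. ennreal (c * (U' \<omega> - V' \<omega>)\<^sup>2) \<partial>M)"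
    if [measurable]: "U' \<in> borel_measurable M" "V' \<in> borel_measurable M"
      and "distr M borel U' = distr M borel Z" "distr M borel V' = distr M borel V" for U' V'
  proof -
    have "(\<integral>\<^sup>+ \<omega>. ennreal ((U \<omega> - V \<omega>)\<^sup>2) \<partial>M) \<le> (\<integral>\<^sup>+ \<omega>. ennreal ((U' \<omega> - V' \<omega>)\<^sup>2) \<partial>M)"
      by (rule comonotone_minimizes_square_diff[where A=A]) (use that lawU A in auto)
    then show ?thesis
      using \<open>0 \<le> c\<close> by (simp add: ennreal_mult nn_integral_cmult mult_left_mono)
  qed
  then show ?thesis
    using lawU unfolding bregman_wasserstein_def bregman_scaled_square
    by (intro bexI[of _ U] conjI INF_greatest) (auto simp: couplings_def)
qed

section \<open>The linear direction of \<open>g\<close>, and diagonal quadratic forms\<close>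

text \<open>\<open>w\<close> carries \<open>\<beta>\<close> on the linear coordinates and 0 on the
  first \<open>m\<close>. Hence \<open>gt\<close> does not see a shift along \<open>w\<close>, and
  the linear part grows by \<open>t\<close> times the inner product of \<open>\<beta>\<close> with
  itself. If \<open>m = CARD('n)\<close>, then \<open>w = 0\<close>.\<close>

lemma linear_decomposition_direction:
  fixes g :: "real^'n \<Rightarrow> real"
  assumes e: "bij_betw e {..<CARD('n)} UNIV" and dec: "linear_decomposition e g m gt \<beta>"
  shows "\<exists>w. w \<bullet> w = (L2_set \<beta> {..<CARD('n) - m})\<^sup>2 \<and>
           (\<forall>x t. g (x + t *\<^sub>R w) = g x + t * (L2_set \<beta> {..<CARD('n) - m})\<^sup>2)"
proof -
  let ?I = "{..<CARD('n) - m}"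
  have m: "m \<le> CARD('n)"
    and g: "g x = gt (\<lambda>i. x $ e i) + (\<Sum>i\<in>?I. \<beta> i * x $ e (m + i))" for x
    using dec by (auto simp: linear_decomposition_def)
  obtain L where L: "\<bar>gt u - gt v\<bar> \<le> L * L2_set (\<lambda>i. u i - v i) {..<m}" for u v
    using dec by (auto simp: linear_decomposition_def)
  \<comment> \<open>The Lipschitz bound at distance zero, whatever the constant
    \<open>L\<close>.\<close>
  have gt_cong: "gt u = gt v" if "\<And>i. i < m \<Longrightarrow> u i = v i" for u v
    using L[of u v] that by (simp add: L2_set_def)
  have e_eq: "e i = e j \<longleftrightarrow> i = j" if "i < CARD('n)" "j < CARD('n)" for i j
    using e that by (auto simp: bij_betw_def inj_on_eq_iff)
  define w :: "real^'n" where "w = (\<Sum>i\<in>?I. \<beta> i *\<^sub>R axis (e (m + i)) 1)"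
  have w_lin: "w $ e (m + k) = \<beta> k" if "k \<in> ?I" for k
  proof -
    have "w $ e (m + k) = (\<Sum>i\<in>?I. if i = k then \<beta> i else 0)"
      unfolding w_def sum_component
      by (rule sum.cong) (use that in \<open>auto simp: axis_def e_eq\<close>)
    then show ?thesis using that by simp
  qed
  have w_0: "w $ e k = 0" if "k < m" for k
    unfolding w_def sum_component
    by (rule sum.neutral) (use that m in \<open>auto simp: axis_def e_eq\<close>)
  have norm_\<beta>: "(L2_set \<beta> ?I)\<^sup>2 = (\<Sum>i\<in>?I. \<beta> i * \<beta> i)"
    by (simp add: L2_set_def sum_nonneg power2_eq_square)
  have "w \<bullet> w = (\<Sum>i\<in>?I. \<beta> i * w $ e (m + i))"
    by (subst (2) w_def) (simp add: inner_sum_right inner_axis)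
  also have "\<dots> = (L2_set \<beta> ?I)\<^sup>2"
    by (simp add: norm_\<beta> w_lin)
  finally have "w \<bullet> w = (L2_set \<beta> ?I)\<^sup>2" .
  moreover have "g (x + t *\<^sub>R w) = g x + t * (L2_set \<beta> ?I)\<^sup>2" for x t
  proof -
    have "gt (\<lambda>i. (x + t *\<^sub>R w) $ e i) = gt (\<lambda>i. x $ e i)"
      by (rule gt_cong) (simp add: w_0)
    moreover have "(\<Sum>i\<in>?I. \<beta> i * (x + t *\<^sub>R w) $ e (m + i)) =
        (\<Sum>i\<in>?I. \<beta> i * x $ e (m + i)) + t * (\<Sum>i\<in>?I. \<beta> i * \<beta> i)"
      unfolding sum_distrib_left sum.distrib[symmetric]
      by (rule sum.cong) (simp_all add: w_lin distrib_left mult.left_commute)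
    ultimately show ?thesis
      by (simp add: g norm_\<beta>)
  qed
  ultimately show ?thesis by blast
qed

lemma diagonal_matrix_vector_mult:
  fixes Q :: "real^'n^'n"
  assumes "\<And>i j. i \<noteq> j \<Longrightarrow> Q $ i $ j = 0"
  shows "(Q *v x) $ i = Q $ i $ i * x $ i"
proof -
  have "(Q *v x) $ i = (\<Sum>j\<in>UNIV. if j = i then Q $ i $ i * x $ i else 0)"
    unfolding matrix_vector_mult_def vec_lambda_beta
    by (rule sum.cong) (use assms in auto)
  then show ?thesis by simp
qed

lemma eigenvalues_diagonal:
  fixes Q :: "real^'n^'n"
  assumes "\<And>i j. i \<noteq> j \<Longrightarrow> Q $ i $ j = 0"
  shows "eigenvalues Q = range (\<lambda>i. Q $ i $ i)"
proof (intro set_eqI iffI)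
  fix l assume "l \<in> eigenvalues Q"
  then obtain v where "v \<noteq> 0" "Q *v v = l *\<^sub>R v"
    by (auto simp: eigenvalues_def)
  moreover from \<open>v \<noteq> 0\<close> obtain i where "v $ i \<noteq> 0"
    by (auto simp: vec_eq_iff)
  ultimately have "Q $ i $ i = l"
    using diagonal_matrix_vector_mult[OF assms, of v i] by simp
  then show "l \<in> range (\<lambda>i. Q $ i $ i)" by blast
next
  fix l assume "l \<in> range (\<lambda>i. Q $ i $ i)"
  then obtain i where "l = Q $ i $ i" by blast
  then have "Q *v axis i 1 = l *\<^sub>R axis i 1"
    by (simp add: vec_eq_iff diagonal_matrix_vector_mult[OF assms] axis_def)
  then show "l \<in> eigenvalues Q"
    unfolding eigenvalues_def by (auto intro!: exI[of _ "axis i 1"])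
qed

lemma diagonal_quadratic_form_bounds:
  fixes Q :: "real^'n^'n"
  assumes diag: "\<And>i j. i \<noteq> j \<Longrightarrow> Q $ i $ j = 0"
    and "\<And>l. l \<in> eigenvalues Q \<Longrightarrow> lmin \<le> l" "\<And>l. l \<in> eigenvalues Q \<Longrightarrow> l \<le> lmax"
  shows "lmin * (x \<bullet> x) \<le> x \<bullet> (Q *v x)" "x \<bullet> (Q *v x) \<le> lmax * (x \<bullet> x)"
proof -
  have form: "x \<bullet> (Q *v x) = (\<Sum>i\<in>UNIV. Q $ i $ i * (x $ i * x $ i))"
    by (simp add: inner_vec_def diagonal_matrix_vector_mult[OF diag] ac_simps)
  have norm: "c * (x \<bullet> x) = (\<Sum>i\<in>UNIV. c * (x $ i * x $ i))" for c
    by (simp add: inner_vec_def sum_distrib_left)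
  show "lmin * (x \<bullet> x) \<le> x \<bullet> (Q *v x)" "x \<bullet> (Q *v x) \<le> lmax * (x \<bullet> x)"
    unfolding form norm
    using assms(2,3) by (auto intro!: sum_mono mult_right_mono simp: eigenvalues_diagonal[OF diag])
qed

section \<open>The two inclusions\<close>

theorem theorem4:
  fixes M :: "(real^'n) measure"
    and p K \<epsilon> lmin lmax :: real
    and g :: "real^'n \<Rightarrow> real"
    and e :: "nat \<Rightarrow> 'n"
    and m :: nat
    and gt :: "(nat \<Rightarrow> real) \<Rightarrow> real"
    and \<beta> :: "nat \<Rightarrow> real"
    and X :: "real^'n \<Rightarrow> real^'n"
    and Q :: "real^'n^'n"
  assumes "prob_space M" and "sets M = sets borel" and "nonatomic M"
    and "1 \<le> p"
    and "\<not> g constant_on UNIV"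
    and "K-lipschitz_on UNIV g"
    and "bij_betw e {..<CARD('n)} UNIV"
    and "linear_decomposition e g m gt \<beta>"
    and "\<And>m' gt' \<beta>'. linear_decomposition e g m' gt' \<beta>' \<Longrightarrow> m \<le> m'"
    and "X \<in> Lp_vec M p" and "g \<circ> X \<in> Lp_vec M p"
    and "\<And>i j. i \<noteq> j \<Longrightarrow> Q $ i $ j = 0"
    and "\<And>x. 0 \<le> x \<bullet> (Q *v x)"
    and "\<exists>i j. Q $ i $ j \<noteq> 0"
    and "lmin \<in> eigenvalues Q" and "\<And>l. l \<in> eigenvalues Q \<Longrightarrow> lmin \<le> l"
    and "lmax \<in> eigenvalues Q" and "\<And>l. l \<in> eigenvalues Q \<Longrightarrow> l \<le> lmax"
    and "0 \<le> \<epsilon>"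
  shows "laws M (bw_set M (\<lambda>x. lmax * x\<^sup>2) ((L2_set \<beta> {..<CARD('n) - m})\<^sup>2 * \<epsilon>) (g \<circ> X))
           \<subseteq> laws M ((\<circ>) g ` bw_set M (\<lambda>x. x \<bullet> (Q *v x)) \<epsilon> X)
       \<and> (\<circ>) g ` bw_set M (\<lambda>x. x \<bullet> (Q *v x)) \<epsilon> X
           \<subseteq> bw_set M (\<lambda>x. lmin * x\<^sup>2) (K\<^sup>2 * \<epsilon>) (g \<circ> X)"
proof -
  interpret prob_space M by fact
  note diag = assms(12)
  note bounds = diagonal_quadratic_form_bounds[OF diag assms(16,18)]
  note eig = eigenvalues_diagonal[OF diag]
  have nonneg: "0 \<le> Q $ i $ i" for i
    using assms(13)[of "axis i 1"] by (simp add: inner_axis' diagonal_matrix_vector_mult[OF diag])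
  have "0 \<le> lmin"
    using assms(15) nonneg by (auto simp: eig)
  obtain i where "Q $ i $ i \<noteq> 0"
    using assms(14) diag by metis
  then have "0 < lmax"
    using nonneg[of i] assms(18)[of "Q $ i $ i"] by (auto simp: eig)
  have "transpose Q = Q"
    using diag by (auto simp: transpose_def vec_eq_iff) (metis)
  note bregQ = bregman_quadratic_form[OF this]
  have cont: "continuous_on UNIV g"
    using assms(6) by (rule lipschitz_on_continuous_on)
  have [measurable]: "g \<in> borel_measurable borel"
    using cont by (rule borel_measurable_continuous_onI)
  have [measurable]: "X \<in> borel_measurable M"
    using assms(10) by (simp add: Lp_vec_def)

  have "(\<circ>) g ` bw_set M (\<lambda>x. x \<bullet> (Q *v x)) \<epsilon> X \<subseteq> bw_set M (\<lambda>x. lmin * x\<^sup>2) (K\<^sup>2 * \<epsilon>) (g \<circ> X)"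
  proof (rule image_subsetI, rule bw_set_comp)
    have "continuous_on UNIV (\<lambda>z :: (real^'n) \<times> (real^'n). (fst z - snd z) \<bullet> (Q *v (fst z - snd z)))"
      by (intro continuous_intros bounded_linear.continuous_on[OF matrix_vector_mul_bounded_linear])
    then show "case_prod (bregman (\<lambda>x. x \<bullet> (Q *v x))) \<in> borel_measurable (borel \<Otimes>\<^sub>M borel)"
      unfolding borel_prod by (simp add: bregQ case_prod_beta' borel_measurable_continuous_onI)
    \<comment> \<open>The Lipschitz bound costs the factor \<open>K\<^sup>2\<close>; the smallest
      eigenvalue then bounds the quadratic form from below.\<close>
    show "bregman (\<lambda>x. lmin * x\<^sup>2) (g a) (g b) \<le> K\<^sup>2 * bregman (\<lambda>x. x \<bullet> (Q *v x)) a b" for a b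
    proof -
      have "\<bar>g a - g b\<bar> \<le> K * norm (a - b)"
        using lipschitz_onD[OF assms(6), of a b] by (simp add: dist_norm)
      then have "(g a - g b)\<^sup>2 \<le> (K * norm (a - b))\<^sup>2"
        by (metis abs_ge_zero power2_abs power_mono)
      then have "lmin * (g a - g b)\<^sup>2 \<le> lmin * (K * norm (a - b))\<^sup>2"
        using \<open>0 \<le> lmin\<close> by (rule mult_left_mono)
      also have "\<dots> = K\<^sup>2 * (lmin * ((a - b) \<bullet> (a - b)))"
        by (simp add: power_mult_distrib power2_norm_eq_inner ac_simps)
      also have "\<dots> \<le> K\<^sup>2 * ((a - b) \<bullet> (Q *v (a - b)))"
        by (intro mult_left_mono bounds) auto
      finally show ?thesis
        by (simp add: bregQ bregman_scaled_square)
    qed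
  qed (use \<open>0 \<le> \<epsilon>\<close> in auto)

  \<comment> \<open>Left inclusion: \<open>W\<close> is replaced by a rearrangement \<open>U\<close>
    that is optimally coupled to \<open>g \<circ> X\<close>, which is why the claim concerns
    laws.\<close>
  moreover have "distr M borel W \<in> laws M ((\<circ>) g ` bw_set M (\<lambda>x. x \<bullet> (Q *v x)) \<epsilon> X)"
    if W: "W \<in> bw_set M (\<lambda>x. lmax * x\<^sup>2) ((L2_set \<beta> {..<CARD('n) - m})\<^sup>2 * \<epsilon>) (g \<circ> X)" for W
  proof -
    define b where "b = (L2_set \<beta> {..<CARD('n) - m})\<^sup>2"
    have "0 \<le> b" by (simp add: b_def)
    have [measurable]: "W \<in> borel_measurable M"
      using W by (simp add: bw_set_def)
    obtain h :: "real^'n \<Rightarrow> real" where h: "h \<in> borel_measurable borel" "inj h" "range h \<subseteq> {0..1}"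
      using exists_borel_injection_unit_interval by blast
    \<comment> \<open>A level set of the injective \<open>h\<close> is empty or a singleton, and
      singletons are null because \<open>M\<close> is non-atomic.\<close>
    have "prob {\<omega>\<in>space M. h \<omega> = c} = 0" for c
    proof (cases "\<exists>x\<in>space M. h x = c")
      case True
      then obtain x where "{\<omega>\<in>space M. h \<omega> = c} = {x}"
        using \<open>inj h\<close> by (auto dest: injD)
      then show ?thesis
        using nonatomic_measure_singleton[OF assms(2,3)] by simp
    next
      case False
      then have "{\<omega>\<in>space M. h \<omega> = c} = {}" by blast
      then show ?thesis by (metis measure_empty)
    qed
    moreover have "h \<omega> \<in> {0..1}" for \<omega>
      using h(3) by blast
    moreover have "h \<in> borel_measurable M"
      using h(1) assms(2) by (simp cong: measurable_cong_sets)
    ultimately obtain U where [measurable]: "U \<in> borel_measurable M"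
      and lawU: "distr M borel U = distr M borel W"
      and "(\<integral>\<^sup>+ \<omega>. ennreal (lmax * (U \<omega> - (g \<circ> X) \<omega>)\<^sup>2) \<partial>M)
            \<le> bregman_wasserstein M (\<lambda>x. lmax * x\<^sup>2) (distr M borel W) (distr M borel (g \<circ> X))"
      using exists_optimal_square_coupling[of "g \<circ> X" W h lmax] \<open>0 < lmax\<close> by (auto simp: comp_def)
    then have cost: "(\<integral>\<^sup>+ \<omega>. ennreal (lmax * (U \<omega> - g (X \<omega>))\<^sup>2) \<partial>M) \<le> ennreal (b * \<epsilon>)"
      using W by (auto simp: bw_set_def b_def intro: order_trans)
    have "\<exists>Z\<in>bw_set M (\<lambda>x. x \<bullet> (Q *v x)) \<epsilon> X. distr M borel (g \<circ> Z) = distr M borel U"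
    proof (cases "b = 0")
      case True
      \<comment> \<open>The radius \<open>b * \<epsilon>\<close> is zero, so \<open>0 < lmax\<close>
        forces \<open>U = g \<circ> X\<close> almost surely; \<open>X\<close> coupled with itself
        has cost 0.\<close>
      then have "(\<integral>\<^sup>+ \<omega>. ennreal (lmax * (U \<omega> - g (X \<omega>))\<^sup>2) \<partial>M) = 0"
        using cost by simp
      then have "AE \<omega> in M. ennreal (lmax * (U \<omega> - g (X \<omega>))\<^sup>2) = 0"
        by (subst (asm) nn_integral_0_iff_AE) auto
      then have "AE \<omega> in M. U \<omega> = (g \<circ> X) \<omega>"
        by eventually_elim
           (use \<open>0 < lmax\<close> in \<open>auto simp: ennreal_eq_0_iff mult_le_0_iff power2_eq_square\<close>)
      then have "distr M borel (g \<circ> X) = distr M borel U"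
        by (intro distr_cong_AE) auto
      moreover have "X \<in> bw_set M (\<lambda>x. x \<bullet> (Q *v x)) \<epsilon> X"
        using bregman_wasserstein_le_coupling[of X M X _ _ "\<lambda>x. x \<bullet> (Q *v x)"]
        by (simp add: bw_set_def bregQ)
      ultimately show ?thesis by blast
    next
      case False
      with \<open>0 \<le> b\<close> have "0 < b" by simp
      obtain w where w: "w \<bullet> w = b" "\<And>x t. g (x + t *\<^sub>R w) = g x + t * b"
        using linear_decomposition_direction[OF assms(7,8)] by (auto simp: b_def)
      \<comment> \<open>Along \<open>w\<close> the function \<open>g\<close> grows at rate
        \<open>b\<close>, so this multiple raises \<open>g (X \<omega>)\<close> exactly to
        \<open>U \<omega>\<close>. Since \<open>w \<bullet> w = b\<close>, the squared length of the
        shift is \<open>(U \<omega> - g (X \<omega>))\<^sup>2 / b\<close>, which cancels the factor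
        \<open>b\<close> in the radius.\<close>
      define Z where "Z \<omega> = X \<omega> + ((U \<omega> - g (X \<omega>)) / b) *\<^sub>R w" for \<omega>
      have [measurable]: "Z \<in> borel_measurable M"
        unfolding Z_def by measurable
      have "g \<circ> Z = U"
        using \<open>0 < b\<close> by (auto simp: Z_def w)
      have breg: "bregman (\<lambda>x. x \<bullet> (Q *v x)) (Z \<omega>) (X \<omega>) \<le> 1 / b * (lmax * (U \<omega> - g (X \<omega>))\<^sup>2)" for \<omega>
      proof -
        have "bregman (\<lambda>x. x \<bullet> (Q *v x)) (Z \<omega>) (X \<omega>) \<le> lmax * ((Z \<omega> - X \<omega>) \<bullet> (Z \<omega> - X \<omega>))"
          unfolding bregQ by (rule bounds)
        also have "\<dots> = 1 / b * (lmax * (U \<omega> - g (X \<omega>))\<^sup>2)"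
          using \<open>0 < b\<close> by (simp add: Z_def w power2_eq_square field_simps)
        finally show ?thesis .
      qed
      have "(\<integral>\<^sup>+ \<omega>. ennreal (bregman (\<lambda>x. x \<bullet> (Q *v x)) (Z \<omega>) (X \<omega>)) \<partial>M) \<le>
          (\<integral>\<^sup>+ \<omega>. ennreal (1 / b) * ennreal (lmax * (U \<omega> - g (X \<omega>))\<^sup>2) \<partial>M)"
        using breg \<open>0 < b\<close> by (intro nn_integral_mono) (simp add: ennreal_mult'[symmetric] ennreal_leI)
      also have "\<dots> = ennreal (1 / b) * (\<integral>\<^sup>+ \<omega>. ennreal (lmax * (U \<omega> - g (X \<omega>))\<^sup>2) \<partial>M)"
        by (rule nn_integral_cmult) measurable
      also have "\<dots> \<le> ennreal (1 / b) * ennreal (b * \<epsilon>)"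
        by (intro mult_left_mono cost) auto
      also have "\<dots> = ennreal \<epsilon>"
        using \<open>0 < b\<close> by (simp add: ennreal_mult'[symmetric])
      finally have "Z \<in> bw_set M (\<lambda>x. x \<bullet> (Q *v x)) \<epsilon> X"
        unfolding bw_set_def
        using order_trans[OF bregman_wasserstein_le_coupling[of Z M X]] by simp
      with \<open>g \<circ> Z = U\<close> show ?thesis by blast
    qed
    then obtain Z where "Z \<in> bw_set M (\<lambda>x. x \<bullet> (Q *v x)) \<epsilon> X"
      "distr M borel (g \<circ> Z) = distr M borel W"
      using lawU by auto
    then show ?thesis
      unfolding laws_def by (metis imageI)
  qed
  ultimately show ?thesis
    by (auto simp: laws_def[of M "bw_set M (\<lambda>x. lmax * x\<^sup>2) _ _"])
qed

end
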